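(* Let $(X,d)$ be a metric space, let $A,B$ be nonempty subsets of $X$, let $T:A\to B$ be a mapping, and let $\mu=\inf\{d(x,u): x,u\in A \text{ such that } x\neq u\}$. If $T$ is a Pata type proximal $x_0$-contraction with $x_0\in A_0$ such that $TA_0\subset B_0$ and $C_{x_0,\mu}\subset A_0$, then $C_{x_0,\mu}$ is a best proximity circle of $T$, that is, $d(u,Tu)=\mathsf{d}(A,B)$ for all $u\in C_{x_0,\mu}$.
   Context: Notation: $\mathsf{d}(A,B)=\inf\{d(u,v):u\in A,\ v\in B\}$; $A_0=\{u\in A: d(u,v)=\mathsf{d}(A,B)\text{ for some }v\in B\}$; $B_0=\{v\in B: d(u,v)=\mathsf{d}(A,B)\text{ for some }u\in A\}$. For $x_0\in A$ and $r\ge 0$, the circle is $C_{x_0,r}=\{u\in A: d(u,x_0)=r\}$; it is called a best proximity circle (proximity circle) of $T:A\to B$ if $d(u,Tu)=\mathsf{d}(A,B)$ for all $u\in C_{x_0,r}$. $\Theta$ denotes the class of all increasing (i.e. nondecreasing) functions $\Psi:[0,1]\to[0,\infty)$ with $\Psi(0)=0$ (no continuity is required). Let $\Lambda\ge 0$, $\alpha\ge 1$ and $\beta\in[0,\alpha]$ be any constants. For $x_0\in A_0$, the mapping $T:A\to B$ is called a Pata type proximal $x_0$-contraction if there exists $\Psi\in\Theta$ such that for all $x\in A$, all $u\in A$ with $d(u,Tx)=\mathsf{d}(A,B)$, and each $\varepsilon\in[0,1]$, $$d(x,u)\le \frac{1-\varepsilon}{2}d(x,x_0)+\Lambda\varepsilon^{\alpha}\Psi(\varepsilon)\left[1+\|x\|+\|x_0\|\right]^{\beta},$$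 where $\|x\|=d(x,x_0)$. *)

theory Defs
  imports "HOL-Analysis.Analysis"
begin

text \<open>\<open>setdist A B\<close> is the infimum of the distances between points of \<open>A\<close> and \<open>B\<close> for nonempty
  \<open>A\<close> and \<open>B\<close>. A mapping from \<open>A\<close> to \<open>B\<close> is a total function \<open>T\<close> with \<open>T \<in> A \<rightarrow> B\<close>;
  its values outside \<open>A\<close> are never used.\<close>

definition prox_left :: "'a::metric_space set \<Rightarrow> 'a set \<Rightarrow> 'a set" where
  "prox_left A B = {u \<in> A. \<exists>v\<in>B. dist u v = setdist A B}"

definition prox_right :: "'a::metric_space set \<Rightarrow> 'a set \<Rightarrow> 'a set" where
  "prox_right A B = {v \<in> B. \<exists>u\<in>A. dist u v = setdist A B}"

text \<open>Radii are extended reals because the infimum in \<open>min_separation\<close> below ranges over the empty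
  set, and so equals \<open>\<infinity>\<close>, when \<open>A\<close> is a singleton; the circle of radius \<open>\<infinity>\<close> is empty.\<close>

definition circle_in :: "'a::metric_space set \<Rightarrow> 'a \<Rightarrow> ereal \<Rightarrow> 'a set" where
  "circle_in A x0 r = {u \<in> A. ereal (dist u x0) = r}"

definition min_separation :: "'a::metric_space set \<Rightarrow> ereal" where
  "min_separation A = Inf {ereal (dist x u) |x u. x \<in> A \<and> u \<in> A \<and> x \<noteq> u}"

definition best_proximity_circle ::
    "'a::metric_space set \<Rightarrow> 'a set \<Rightarrow> ('a \<Rightarrow> 'a) \<Rightarrow> 'a \<Rightarrow> ereal \<Rightarrow> bool" where
  "best_proximity_circle A B T x0 r \<longleftrightarrow> (\<forall>u \<in> circle_in A x0 r. dist u (T u) = setdist A B)"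

text \<open>Functions from \<open>[0,1]\<close> to \<open>[0,\<infinity>)\<close>, represented by total functions whose values outside
  \<open>[0,1]\<close> are irrelevant. Increasing means nondecreasing.\<close>

definition Pata_Theta :: "(real \<Rightarrow> real) set" where
  "Pata_Theta = {\<Psi>. \<Psi> \<in> {0..1} \<rightarrow> {0..} \<and> mono_on {0..1} \<Psi> \<and> \<Psi> 0 = 0}"

text \<open>The norm of \<open>x\<close> in the original is the distance from \<open>x\<close> to \<open>x0\<close>. Both real powers have
  the intended value: the base \<open>\<epsilon>\<close> may be 0, but only with exponent \<open>\<alpha> \<ge> 1\<close>, and the other base
  is at least 1.\<close>

definition Pata_proximal_contraction ::
    "real \<Rightarrow> real \<Rightarrow> real \<Rightarrow> 'a::metric_space set \<Rightarrow> 'a set \<Rightarrow> 'a \<Rightarrow> ('a \<Rightarrow> 'a) \<Rightarrow> bool" where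
  "Pata_proximal_contraction \<Lambda> \<alpha> \<beta> A B x0 T \<longleftrightarrow>
    (\<exists>\<Psi> \<in> Pata_Theta. \<forall>x\<in>A. \<forall>u\<in>A. dist u (T x) = setdist A B \<longrightarrow>
      (\<forall>\<epsilon>\<in>{0..1}. dist x u \<le> (1 - \<epsilon>) / 2 * dist x x0
        + \<Lambda> * \<epsilon> powr \<alpha> * \<Psi> \<epsilon> * (1 + dist x x0 + dist x0 x0) powr \<beta>))"

end

theory Submission
  imports Defs
begin

text \<open>Take \<open>x\<close> on the circle and \<open>u \<in> A\<close> proximal to \<open>T x\<close>. The contraction condition at
  \<open>\<epsilon> = 0\<close> gives \<open>d(x, u) \<le> d(x, x0) / 2\<close>, half the minimal separation of \<open>A\<close>, which forces
  \<open>u = x\<close>.\<close>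

theorem theorem3p3:
  fixes A B :: "'a::metric_space set" and T :: "'a \<Rightarrow> 'a" and x0 :: 'a
    and \<Lambda> \<alpha> \<beta> :: real
  assumes "A \<noteq> {}" and "B \<noteq> {}"
    and "T \<in> A \<rightarrow> B"
    and "\<Lambda> \<ge> 0" and "\<alpha> \<ge> 1" and "\<beta> \<in> {0..\<alpha>}"
    and "x0 \<in> prox_left A B"
    and "Pata_proximal_contraction \<Lambda> \<alpha> \<beta> A B x0 T"
    and "T ` prox_left A B \<subseteq> prox_right A B"
    and "circle_in A x0 (min_separation A) \<subseteq> prox_left A B"
  shows "best_proximity_circle A B T x0 (min_separation A)"
  unfolding best_proximity_circle_def
proof
  fix x assume x: "x \<in> circle_in A x0 (min_separation A)"
  then have xA: "x \<in> A" and r: "ereal (dist x x0) = min_separation A"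
    by (auto simp: circle_in_def)
  have "T x \<in> prox_right A B"
    using x assms(9,10) by blast
  then obtain u where u: "u \<in> A" "dist u (T x) = setdist A B"
    by (auto simp: prox_right_def)
  obtain \<Psi> where \<Psi>: "\<forall>x\<in>A. \<forall>u\<in>A. dist u (T x) = setdist A B \<longrightarrow>
      (\<forall>\<epsilon>\<in>{0..1}. dist x u \<le> (1 - \<epsilon>) / 2 * dist x x0
        + \<Lambda> * \<epsilon> powr \<alpha> * \<Psi> \<epsilon> * (1 + dist x x0 + dist x0 x0) powr \<beta>)"
    using assms(8) unfolding Pata_proximal_contraction_def by blast
  \<comment> \<open>The perturbation term vanishes at \<epsilon> = 0 through its factor
    \<open>0 powr \<alpha> = 0\<close>.\<close>
  have half: "dist x u \<le> dist x x0 / 2"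
    using \<Psi>[rule_format, OF xA u, of 0] by simp
  have "x = u"
  proof (rule ccontr)
    assume "x \<noteq> u"
    then have "min_separation A \<le> ereal (dist x u)"
      unfolding min_separation_def using xA u(1) by (intro Inf_lower) blast
    \<comment> \<open>Being on the circle makes the separation equal to the finite value
      \<open>ereal (dist x x0)\<close>, so the extended-real bound descends to the reals.\<close>
    then have "dist x x0 \<le> dist x u"
      by (simp flip: r)
    \<comment> \<open>Chaining both bounds, \<open>dist x u\<close> is at most half of
      itself.\<close>
    with half have "dist x u \<le> 0"
      by linarith
    with \<open>x \<noteq> u\<close> show False
      by simp
  qed
  with u(2) show "dist x (T x) = setdist A B"
    by simp
qed

end
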